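(* Let $\sigma_1, \sigma_2, \ldots, \sigma_k$ be an order-forced sequence of codewords in a code $\mathcal{C}\subseteq 2^{[n]}$. Let $\mathcal{U} = \{U_1, \ldots ,U_n\}$ be a (closed or open) convex realization of $\mathcal{C}$ in $\mathbb{R}^d$ for some $d$, and let $x\in A^{\mathcal{U}}_{\sigma_1}$ and $y\in A^{\mathcal{U}}_{\sigma_k}$. Then the line segment $\overline{xy}$ must pass through the atoms of $\sigma_1, \sigma_2, \ldots, \sigma_k$, in this order; that is, there are points $q_1,\ldots,q_k$ occurring in this order along $\overline{xy}$ from $x$ to $y$ with $q_i\in A^{\mathcal{U}}_{\sigma_i}$ for each $i$.
   Context: $[n]=\{1,\ldots,n\}$. A (neural) code is a subset $\mathcal{C}\subseteq 2^{[n]}$; its elements are codewords. For a collection $\mathcal{U}=\{U_1,\ldots,U_n\}$ of subsets of $\mathbb{R}^d$ and $\sigma\subseteq[n]$, the atom of $\sigma$ is $A^{\mathcal{U}}_\sigma=\bigcap_{i\in\sigma}U_i\setminus\bigcup_{j\notin\sigma}U_j$ (the empty intersection is $\mathbb{R}^d$). $\mathcal{U}$ is a realization of $\mathcal{C}$ if for all $\sigma\subseteq[n]$: $\sigma\in\mathcal{C}\Leftrightarrow A^{\mathcal{U}}_\sigma\neq\varnothing$. It is an open (respectively closed) convex realization if all $U_i$ are convex and open (respectively all convex and closed). The codeword containment graph $G_{\mathcal{C}}$ has the codewords of $\mathcal{C}$ as vertices, with an edge $\{\sigma,\tau\}$ whenever $\sigma\subsetneq\tau$ or $\tau\subsetneq\sigma$.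 A walk $v_1,v_2,\ldots,v_m$ in $G_{\mathcal{C}}$ is feasible if $v_i\cap v_j\subseteq v_l$ for all $1\le i<l<j\le m$. A path is a walk with no repeated vertices; a $\sigma,\tau$ path is a path from $\sigma$ to $\tau$. A sequence of codewords $\sigma_1,\ldots,\sigma_k$ is order-forced if every feasible $\sigma_1,\sigma_k$ path in $G_{\mathcal{C}}$ contains $\sigma_1,\ldots,\sigma_k$ as a subsequence. *)

theory Defs
  imports
    "HOL-Analysis.Analysis"
    "HOL-Library.Sublist"
    "Graph_Theory.Pair_Digraph"
    "Graph_Theory.Vertex_Walk"
begin

text \<open>
  A code on \<open>[n]\<close> is a set \<open>C \<subseteq> Pow {1..n}\<close>. A collection \<open>U\<^sub>1, \<dots>, U\<^sub>n\<close> is a function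
  \<open>U\<close> of which only the values on \<open>{1..n}\<close> are used.
\<close>

definition code_atom :: "nat \<Rightarrow> (nat \<Rightarrow> 'a set) \<Rightarrow> nat set \<Rightarrow> 'a set" where
  "code_atom n U \<sigma> = (\<Inter>i\<in>\<sigma>. U i) - (\<Union>j\<in>{1..n} - \<sigma>. U j)"

definition realization :: "nat \<Rightarrow> nat set set \<Rightarrow> (nat \<Rightarrow> 'a set) \<Rightarrow> bool" where
  "realization n C U \<longleftrightarrow> (\<forall>\<sigma>\<subseteq>{1..n}. \<sigma> \<in> C \<longleftrightarrow> code_atom n U \<sigma> \<noteq> {})"

definition open_convex_realization ::
    "nat \<Rightarrow> nat set set \<Rightarrow> (nat \<Rightarrow> (real ^ 'd) set) \<Rightarrow> bool" where
  "open_convex_realization n C U \<longleftrightarrow>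
     realization n C U \<and> (\<forall>i\<in>{1..n}. convex (U i) \<and> open (U i))"

definition closed_convex_realization ::
    "nat \<Rightarrow> nat set set \<Rightarrow> (nat \<Rightarrow> (real ^ 'd) set) \<Rightarrow> bool" where
  "closed_convex_realization n C U \<longleftrightarrow>
     realization n C U \<and> (\<forall>i\<in>{1..n}. convex (U i) \<and> closed (U i))"

text \<open>An undirected edge is represented by the two opposite arcs, as usual in \<open>Graph_Theory\<close>.\<close>

definition containment_graph :: "'a set set \<Rightarrow> 'a set pair_pre_digraph" where
  "containment_graph C =
     \<lparr>pverts = C, parcs = {(\<sigma>, \<tau>). \<sigma> \<in> C \<and> \<tau> \<in> C \<and> (\<sigma> \<subset> \<tau> \<or> \<tau> \<subset> \<sigma>)}\<rparr>"

definition feasible :: "'a set list \<Rightarrow> bool" where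
  "feasible v \<longleftrightarrow>
     (\<forall>i l j. i < l \<and> l < j \<and> j < length v \<longrightarrow> v ! i \<inter> v ! j \<subseteq> v ! l)"

definition order_forced :: "'a set set \<Rightarrow> 'a set list \<Rightarrow> bool" where
  "order_forced C \<sigma>s \<longleftrightarrow>
     \<sigma>s \<noteq> [] \<and> set \<sigma>s \<subseteq> C \<and>
     (\<forall>p. vpath p (with_proj (containment_graph C)) \<and> feasible p \<and>
          hd p = hd \<sigma>s \<and> last p = last \<sigma>s \<longrightarrow> subseq \<sigma>s p)"

lemma pair_graph_containment_graph:
  assumes "finite C"
  shows "pair_graph (containment_graph C)"
proof
  show "finite (parcs (containment_graph C))"
    by (rule finite_subset[of _ "C \<times> C"]) (use assms in \<open>auto simp: containment_graph_def\<close>)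
qed (use assms in \<open>auto simp: containment_graph_def symmetric_def arcs_ends_def
       arc_to_ends_def intro!: symI\<close>)

end

theory Submission
  imports Defs
begin

text \<open>
  Label every time \<open>t\<close> by the codeword of the point of the segment at time \<open>t\<close>: the set of all
  \<open>i\<close> whose \<open>U i\<close> contains that point. Convexity makes each \<open>i\<close> present during an interval of times,
  so the codewords read off at increasing times always satisfy the feasibility condition
  (\<open>feasible_codewords_along_line\<close>). It remains to select finitely many times, starting at \<open>0\<close>
  and ending at \<open>1\<close>, whose codewords form a path in the containment graph: order-forcedness then
  finds \<open>\<sigma>s\<close> inside that path, and the times at which its entries are attained are the points
  sought.

  Topology enters only through semicontinuity. If all \<open>U i\<close> are closed, a point has a
  neighbourhood whose codewords are subsets of its own; if all are open, they are supersets. In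
  both cases a point's codeword is comparable with all nearby ones
  (\<open>eventually_comparable_codewords\<close>). Compactness of the unit interval, in the form of Bolzano's
  bisection principle, strings these local comparisons together into a finite increasing list of
  times with consecutive codewords comparable (\<open>chain_of_locally_related\<close>). Cutting out the
  stretch between two visits to the same codeword removes repetitions
  (\<open>loop_erasure_of_labelled_walk\<close>). As the remaining times are still increasing, feasibility
  survives the cuts, and comparable distinct codewords are properly contained in one another.
\<close>

section \<open>Chains and loop erasure\<close>

text \<open>
  Two chains that share an end point can be concatenated, the shared point then occurring twice in
  a row, which reflexivity permits. For \<open>u \<le> t \<le> v\<close> with \<open>u\<close> and \<open>v\<close> close to \<open>t\<close>, the list
  \<open>[u, t, v]\<close> is a chain. These two facts are what bisection needs.
\<close>

lemma chain_of_locally_related: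
  fixes R :: "real \<Rightarrow> real \<Rightarrow> bool"
  assumes "a \<le> b" and "reflp R" and "symp R"
    and loc: "\<And>t. a \<le> t \<Longrightarrow> t \<le> b \<Longrightarrow> \<forall>\<^sub>F s in nhds t. R s t"
  shows "\<exists>ts. ts \<noteq> [] \<and> sorted ts \<and> set ts \<subseteq> {a..b} \<and> hd ts = a \<and> last ts = b \<and>
              successively R ts"
  using \<open>a \<le> b\<close>
proof (induction rule: Bolzano)
  case (trans a b c)
  from trans(1) obtain xs where xs: "xs \<noteq> []" "sorted xs" "set xs \<subseteq> {a..b}" "hd xs = a"
    "last xs = b" "successively R xs" by blast
  from trans(2) obtain ys where ys: "ys \<noteq> []" "sorted ys" "set ys \<subseteq> {b..c}" "hd ys = b"
    "last ys = c" "successively R ys" by blast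
  have "sorted (xs @ ys)"
    using xs ys by (force simp: sorted_append)
  moreover have "successively R (xs @ ys)"
    using xs ys \<open>reflp R\<close> by (simp add: successively_append_iff reflpD)
  moreover have "set (xs @ ys) \<subseteq> {a..c}"
    using xs ys trans(3,4) by force
  ultimately show ?case
    using xs ys by (intro exI[of _ "xs @ ys"]) auto
next
  case (local t)
  from loc[OF local] obtain d where "d > 0" and d: "\<And>s. dist s t < d \<Longrightarrow> R s t"
    by (auto simp: eventually_nhds_metric)
  show ?case
  proof (intro exI[of _ d] conjI allI impI \<open>d > 0\<close>)
    fix u v :: real
    assume uv: "u \<le> t \<and> t \<le> v \<and> v - u < d"
    then have "R u t" and "R v t"
      by (auto intro!: d simp: dist_real_def)
    then show "\<exists>ts. ts \<noteq> [] \<and> sorted ts \<and> set ts \<subseteq> {u..v} \<and> hd ts = u \<and> last ts = v \<and>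
                    successively R ts"
      using uv sympD[OF \<open>symp R\<close>] by (intro exI[of _ "[u, t, v]"]) auto
  qed
qed

text \<open>
  The loops are erased from the walk of labels \<open>map f ts\<close>, but the result is stated for the list
  \<open>ts\<close> itself, since the surviving path has to keep the times at which its labels occur.
\<close>

lemma loop_erasure_of_labelled_walk:
  assumes "ts \<noteq> []" and "successively R (map f ts)"
  shows "\<exists>us. subseq us ts \<and> us \<noteq> [] \<and> distinct (map f us) \<and> successively R (map f us) \<and>
              f (hd us) = f (hd ts) \<and> f (last us) = f (last ts)"
  using assms
proof (induction "length ts" arbitrary: ts rule: less_induct)
  case less
  show ?case
  proof (cases "distinct (map f ts)")
    case True
    then show ?thesis using less.prems by (intro exI[of _ ts]) auto
  next
    case False
    then obtain xs ys zs z where "map f ts = xs @ [z] @ ys @ [z] @ zs"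
      using not_distinct_decomp by blast
    then obtain as a bs b cs where ts: "ts = as @ a # bs @ b # cs" and ab: "f a = f b"
      by (auto simp: map_eq_append_conv map_eq_Cons_conv append_eq_map_conv Cons_eq_map_conv)
    let ?vs = "as @ b # cs"
    have "successively R (map f ?vs)"
      using less.prems(2) ab by (auto simp: ts successively_append_iff successively_Cons)
    then obtain us where us: "subseq us ?vs" "us \<noteq> []" "distinct (map f us)"
      "successively R (map f us)" "f (hd us) = f (hd ?vs)" "f (last us) = f (last ?vs)"
      using less.hyps[of ?vs] by (auto simp: ts)
    have "subseq (b # cs) (a # bs @ b # cs)"
      by (metis append_Cons list_emb_append2 subseq_order.order_refl)
    then have "subseq ?vs ts"
      unfolding ts by (intro list_emb_append_mono subseq_order.order_refl)
    moreover have "f (hd ?vs) = f (hd ts)" and "last ?vs = last ts"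
      using ab by (cases as; simp add: ts)+
    ultimately show ?thesis
      using us subseq_order.order_trans[OF us(1)] by (intro exI[of _ us]) auto
  qed
qed

lemma vwalk_arcs_successively:
  "set (vwalk_arcs p) \<subseteq> {(u, v). Q u v} \<longleftrightarrow> successively Q p"
  by (induction p rule: vwalk_arcs.induct) auto

lemma vpath_containment_graph:
  assumes "p \<noteq> []" and "set p \<subseteq> C" and "distinct p"
    and "successively (\<lambda>S T. S \<subseteq> T \<or> T \<subseteq> S) p"
  shows "vpath p (with_proj (containment_graph C))"
proof -
  have "successively (\<lambda>S T. S \<in> C \<and> T \<in> C \<and> (S \<subset> T \<or> T \<subset> S)) p"
    using assms(2-4) by (induction p rule: induct_list012) auto
  then have "set (vwalk_arcs p) \<subseteq> parcs (containment_graph C)"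
    by (simp add: containment_graph_def flip: vwalk_arcs_successively)
  then show ?thesis
    using assms by (intro vpathI vwalkI) (auto simp: containment_graph_def)
qed

section \<open>Codewords of points\<close>

definition codeword_at :: "nat \<Rightarrow> (nat \<Rightarrow> 'a set) \<Rightarrow> 'a \<Rightarrow> nat set" where
  "codeword_at n U p = {i \<in> {1..n}. p \<in> U i}"

lemma mem_code_atom_iff:
  assumes "\<sigma> \<subseteq> {1..n}"
  shows "p \<in> code_atom n U \<sigma> \<longleftrightarrow> codeword_at n U p = \<sigma>"
  using assms by (auto simp: code_atom_def codeword_at_def)

lemma codeword_at_in_code:
  assumes "realization n C U"
  shows "codeword_at n U p \<in> C"
proof -
  have "codeword_at n U p \<subseteq> {1..n}"
    by (auto simp: codeword_at_def)
  then show ?thesis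
    using assms mem_code_atom_iff[of "codeword_at n U p" n p U] by (auto simp: realization_def)
qed

text \<open>
  For closed sets the finitely many complements of the \<open>U i\<close> that contain \<open>p\<close> intersect in a
  neighbourhood of \<open>p\<close>, where no new index can appear; for open sets the finitely many \<open>U i\<close>
  containing \<open>p\<close> do, and no index can be lost.
\<close>

lemma eventually_comparable_codewords:
  fixes U :: "nat \<Rightarrow> 'a::topological_space set"
  assumes "(\<forall>i\<in>{1..n}. closed (U i)) \<or> (\<forall>i\<in>{1..n}. open (U i))"
  shows "\<forall>\<^sub>F q in nhds p. codeword_at n U q \<subseteq> codeword_at n U p \<or>
                          codeword_at n U p \<subseteq> codeword_at n U q"
  using assms
proof
  assume closed: "\<forall>i\<in>{1..n}. closed (U i)"
  have "\<forall>\<^sub>F q in nhds p. \<forall>i\<in>{1..n} - codeword_at n U p. q \<in> - U i"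
    using closed
    by (intro eventually_ball_finite ballI eventually_nhds_in_open) (auto simp: codeword_at_def)
  then show ?thesis
    by eventually_elim (auto simp: codeword_at_def)
next
  assume "open": "\<forall>i\<in>{1..n}. open (U i)"
  have "\<forall>\<^sub>F q in nhds p. \<forall>i\<in>codeword_at n U p. q \<in> U i"
    using "open"
    by (intro eventually_ball_finite ballI eventually_nhds_in_open) (auto simp: codeword_at_def)
  then show ?thesis
    by eventually_elim (auto simp: codeword_at_def)
qed

lemma linepath_between_in_convex:
  assumes "convex S" and "linepath x y r \<in> S" and "linepath x y t \<in> S" and "r \<le> s" and "s \<le> t"
  shows "linepath x y s \<in> S"
proof -
  have "s \<in> closed_segment r t"
    using assms(4,5) by (auto simp: closed_segment_eq_real_ivl)
  then obtain u where u: "0 \<le> u" "u \<le> 1" and s: "s = (1 - u) * r + u * t"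
    by (auto simp: closed_segment_def)
  have "linepath x y s = (1 - u) *\<^sub>R linepath x y r + u *\<^sub>R linepath x y t"
    by (simp add: linepath_def s algebra_simps)
  then show ?thesis
    using assms(1-3) u by (simp add: convexD_alt)
qed

lemma feasible_codewords_along_line:
  assumes "\<And>i. i \<in> {1..n} \<Longrightarrow> convex (U i)" and "sorted ts"
  shows "feasible (map (\<lambda>t. codeword_at n U (linepath x y t)) ts)"
  unfolding feasible_def
proof (intro allI impI)
  fix i l j
  assume ilj: "i < l \<and> l < j \<and> j < length (map (\<lambda>t. codeword_at n U (linepath x y t)) ts)"
  then have "ts ! i \<le> ts ! l" and "ts ! l \<le> ts ! j"
    using \<open>sorted ts\<close> by (auto intro: sorted_nth_mono)
  then show "map (\<lambda>t. codeword_at n U (linepath x y t)) ts ! i \<inter>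
             map (\<lambda>t. codeword_at n U (linepath x y t)) ts ! j
             \<subseteq> map (\<lambda>t. codeword_at n U (linepath x y t)) ts ! l"
    using ilj assms(1) by (auto simp: codeword_at_def intro: linepath_between_in_convex)
qed

section \<open>Order-forced sequences along a segment\<close>

theorem theorem1p1:
  fixes n :: nat and C :: "nat set set" and \<sigma>s :: "nat set list"
    and U :: "nat \<Rightarrow> (real ^ 'd) set" and x y :: "real ^ 'd"
  assumes "C \<subseteq> Pow {1..n}"
    and "order_forced C \<sigma>s"
    and "closed_convex_realization n C U \<or> open_convex_realization n C U"
    and "x \<in> code_atom n U (hd \<sigma>s)"
    and "y \<in> code_atom n U (last \<sigma>s)"
  shows "\<exists>ts :: real list. length ts = length \<sigma>s \<and> sorted ts \<and> set ts \<subseteq> {0..1} \<and>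
           (\<forall>i<length \<sigma>s. linepath x y (ts ! i) \<in> code_atom n U (\<sigma>s ! i))"
proof -
  define w where "w t = codeword_at n U (linepath x y t)" for t
  let ?comparable = "\<lambda>S T :: nat set. S \<subseteq> T \<or> T \<subseteq> S"

  have real: "realization n C U" and conv: "\<And>i. i \<in> {1..n} \<Longrightarrow> convex (U i)"
    and top: "(\<forall>i\<in>{1..n}. closed (U i)) \<or> (\<forall>i\<in>{1..n}. open (U i))"
    using assms(3) by (auto simp: closed_convex_realization_def open_convex_realization_def)
  have \<sigma>s: "\<sigma>s \<noteq> []" "set \<sigma>s \<subseteq> C"
    using assms(2) by (auto simp: order_forced_def)
  have \<sigma>s_subset: "\<sigma> \<subseteq> {1..n}" if "\<sigma> \<in> set \<sigma>s" for \<sigma>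
    using that \<sigma>s(2) assms(1) by auto
  have w0: "w 0 = hd \<sigma>s" and w1: "w 1 = last \<sigma>s"
    using assms(4,5)[THEN mem_code_atom_iff[THEN iffD1, OF \<sigma>s_subset, rotated]] \<sigma>s(1)
    by (simp_all add: w_def linepath_0' linepath_1')

  have loc: "\<forall>\<^sub>F s in nhds t. ?comparable (w s) (w t)" for t
  proof -
    have "isCont (linepath x y) t"
      by (simp add: linepath_def continuous_intros)
    then have "filterlim (linepath x y) (nhds (linepath x y t)) (nhds t)"
      by (simp add: isCont_def tendsto_at_iff_tendsto_nhds)
    then show ?thesis
      using eventually_comparable_codewords[OF top] unfolding w_def filterlim_iff by blast
  qed
  obtain ts where ts: "ts \<noteq> []" "sorted ts" "set ts \<subseteq> {0..1}" "hd ts = 0" "last ts = 1"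
      "successively (\<lambda>s t. ?comparable (w s) (w t)) ts"
    using chain_of_locally_related[of 0 1 "\<lambda>s t. ?comparable (w s) (w t)"] loc
    by (auto simp: reflp_def symp_def)
  then obtain us where us: "subseq us ts" "us \<noteq> []" "distinct (map w us)"
      "successively ?comparable (map w us)" "w (hd us) = w 0" "w (last us) = w 1"
    using loop_erasure_of_labelled_walk[of ts ?comparable w] by (auto simp: successively_map)
  have "sorted us" and "set us \<subseteq> {0..1}"
    using us(1) ts(2,3) by (auto simp: subseq_conv_nths sorted_nths dest: in_set_nthsD)

  have "vpath (map w us) (with_proj (containment_graph C))"
    using us codeword_at_in_code[OF real]
    by (intro vpath_containment_graph) (auto simp: w_def)
  moreover have "feasible (map w us)"
    unfolding w_def using conv \<open>sorted us\<close> by (rule feasible_codewords_along_line)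
  ultimately have "subseq \<sigma>s (map w us)"
    using assms(2) us w0 w1 by (simp add: order_forced_def hd_map last_map)
  then obtain N where N: "\<sigma>s = map w (nths us N)"
    by (auto simp: subseq_conv_nths nths_map)
  show ?thesis
  proof (intro exI[of _ "nths us N"] conjI allI impI)
    show "length (nths us N) = length \<sigma>s"
      by (simp add: N)
    show "sorted (nths us N)"
      using \<open>sorted us\<close> by (rule sorted_nths)
    show "set (nths us N) \<subseteq> {0..1}"
      using \<open>set us \<subseteq> {0..1}\<close> set_nths_subset by fastforce
  next
    fix i
    assume i: "i < length \<sigma>s"
    then have "w (nths us N ! i) = \<sigma>s ! i"
      by (simp add: N)
    then show "linepath x y (nths us N ! i) \<in> code_atom n U (\<sigma>s ! i)"
      by (simp add: w_def mem_code_atom_iff[OF \<sigma>s_subset[OF nth_mem[OF i]]])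
  qed
qed

end
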